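(* Let $A,B\subseteq\mathbb{N}$ and $L\in\mathbb{R}$. The limit $\lim_{n\to\infty}\frac{B(n)-A(n)}{n}$ exists and equals $L$ if and only if $\mu(B)-\mu(A)=L$ for every density measure $\mu$.
   Context: $\mathbb{N}=\{1,2,3,\dots\}$. For $A\subseteq\mathbb{N}$ let $A(n)=|A\cap[1,n]|$. Let $\mathcal{D}$ be the collection of all $A\subseteq\mathbb{N}$ for which the asymptotic density $d(A)=\lim_{n\to\infty}\frac{A(n)}{n}$ exists. A density measure is a function $\mu:\mathcal{P}(\mathbb{N})\to[0,1]$ with $\mu(\mathbb{N})=1$, $\mu(A\cup B)=\mu(A)+\mu(B)$ for all disjoint $A,B\subseteq\mathbb{N}$, and $\mu(A)=d(A)$ for all $A\in\mathcal{D}$. *)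

theory Defs
  imports Complex_Main
begin

text \<open>The positive integers N = {1,2,3,...} are represented as the subset {1..} of nat.
  Subsets of N are sets A :: nat set with A \<subseteq> {1..}.\<close>

definition pos_nat :: "nat set" where
  "pos_nat = {1..}"

definition counting :: "nat set \<Rightarrow> nat \<Rightarrow> nat" where
  "counting A n = card (A \<inter> {1..n})"

definition has_density :: "nat set \<Rightarrow> real \<Rightarrow> bool" where
  "has_density A d \<longleftrightarrow> ((\<lambda>n. real (counting A n) / real n) \<longlonglongrightarrow> d)"

text \<open>Density measure on the power set of N (values on sets not contained in N are irrelevant).\<close>
definition density_measure :: "(nat set \<Rightarrow> real) \<Rightarrow> bool" where
  "density_measure \<mu> \<longleftrightarrow>
     (\<forall>A. A \<subseteq> pos_nat \<longrightarrow> 0 \<le> \<mu> A \<and> \<mu> A \<le> 1) \<and>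
     \<mu> pos_nat = 1 \<and>
     (\<forall>A B. A \<subseteq> pos_nat \<longrightarrow> B \<subseteq> pos_nat \<longrightarrow> A \<inter> B = {} \<longrightarrow> \<mu> (A \<union> B) = \<mu> A + \<mu> B) \<and>
     (\<forall>A d. A \<subseteq> pos_nat \<longrightarrow> has_density A d \<longrightarrow> \<mu> A = d)"

end

theory Submission
  imports Defs "HOL-Analysis.Analysis"
begin

text \<open>If the ratio tends to \<open>L\<close>, split the complement \<open>M\<close> of the symmetric difference of \<open>A\<close> and
  \<open>B\<close> alternately into two halves \<open>M\<^sub>1\<close>, \<open>M\<^sub>2\<close>. Then \<open>(B - A) \<union> M\<^sub>i\<close> has density \<open>(1 + L) / 2\<close> for
  both \<open>i\<close>, and adding the two values of a density measure on these sets yields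
  \<open>1 + \<mu> (B - A) - \<mu> (A - B) = 1 + L\<close>.
  Conversely, every ultrafilter \<open>U\<close> finer than \<open>sequentially\<close> gives a density measure
  \<open>X \<mapsto> lim\<^sub>U X(n)/n\<close> (the limit exists by compactness of \<open>[0,1]\<close>), so the ratio tends to \<open>L\<close>
  along every such ultrafilter, hence along \<open>sequentially\<close> itself.\<close>

definition ultrafilter :: "'a filter \<Rightarrow> bool" where
  "ultrafilter U \<longleftrightarrow> U \<noteq> bot \<and> (\<forall>P. eventually P U \<or> eventually (\<lambda>x. \<not> P x) U)"

lemma ultrafilter_le_exists:
  fixes F :: "'a filter"
  assumes F: "F \<noteq> bot"
  shows "\<exists>U\<le>F. ultrafilter U"
proof -
  let ?R = "{(b, a). a \<noteq> bot \<and> a \<le> b \<and> b \<le> F}"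
  have bot_notin_R: "c \<in> Chains ?R \<Longrightarrow> bot \<notin> c" for c
    by (auto simp: Chains_def)
  have FR[simp]: "Field ?R = {G. G \<noteq> bot \<and> G \<le> F}"
    by (auto simp: Field_def bot_unique)
  have "\<exists>m\<in>Field ?R. \<forall>a\<in>Field ?R. (m, a) \<in> ?R \<longrightarrow> a = m"
  proof (rule Zorns_po_lemma)
    show "Partial_order ?R"
      by (auto simp: partial_order_on_def preorder_on_def
          antisym_def refl_on_def trans_def Field_def bot_unique)
    show "\<exists>u\<in>Field ?R. \<forall>a\<in>C. (a, u) \<in> ?R" if C: "C \<in> Chains ?R" for C
    proof (simp, intro exI conjI ballI)
      have Inf_C: "Inf C \<noteq> bot" "Inf C \<le> F" if "C \<noteq> {}"
      proof -
        from C that have "Inf C = bot \<longleftrightarrow> (\<exists>x\<in>C. x = bot)"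
          unfolding trivial_limit_def by (intro eventually_Inf_base) (auto simp: Chains_def)
        with C show "Inf C \<noteq> bot"
          by (simp add: bot_notin_R)
        from that obtain x where "x \<in> C" by auto
        with C show "Inf C \<le> F"
          by (auto intro!: Inf_lower2[of x] simp: Chains_def)
      qed
      then have [simp]: "inf F (Inf C) = (if C = {} then F else Inf C)"
        using C by (auto simp add: inf_absorb2)
      from C show "inf F (Inf C) \<noteq> bot"
        by (simp add: F Inf_C)
      from C show "inf F (Inf C) \<le> F"
        by (simp add: Chains_def Inf_C F)
      with C show "inf F (Inf C) \<le> x" "x \<le> F" if "x \<in> C" for x
        using that by (auto intro: Inf_lower simp: Chains_def)
    qed
  qed
  then obtain U where U: "U \<noteq> bot" "U \<le> F"
    and max: "\<And>G. G \<noteq> bot \<Longrightarrow> G \<le> U \<Longrightarrow> G = U"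
    by auto
  have "eventually P U \<or> eventually (\<lambda>x. \<not> P x) U" for P
  proof (rule disjCI)
    assume "\<not> eventually (\<lambda>x. \<not> P x) U"
    then have "inf U (principal {x. P x}) \<noteq> bot"
      by (simp add: trivial_limit_def eventually_inf_principal)
    then have U_eq: "U = inf U (principal {x. P x})"
      by (intro max[symmetric]) simp_all
    show "eventually P U"
      by (subst U_eq) (simp add: eventually_inf_principal)
  qed
  with U show ?thesis
    unfolding ultrafilter_def by blast
qed

lemma ultrafilter_convergent_compact:
  assumes U: "ultrafilter U" and K: "compact K" and g: "eventually (\<lambda>x. g x \<in> K) U"
  shows "\<exists>l\<in>K. (g \<longlongrightarrow> l) U"
proof -
  have "filtermap g U \<noteq> bot"
    using U by (simp add: ultrafilter_def filtermap_bot_iff)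
  with K g obtain l where "l \<in> K" and l: "inf (nhds l) (filtermap g U) \<noteq> bot"
    unfolding compact_filter by (auto simp: eventually_filtermap)
  have "eventually (\<lambda>x. g x \<in> S) U" if "open S" "l \<in> S" for S
  proof (rule ccontr)
    assume "\<not> eventually (\<lambda>x. g x \<in> S) U"
    then have "eventually (\<lambda>y. y \<notin> S) (filtermap g U)"
      using U by (auto simp: ultrafilter_def eventually_filtermap)
    moreover have "eventually (\<lambda>y. y \<in> S) (nhds l)"
      using that eventually_nhds by blast
    ultimately have "eventually (\<lambda>y. False) (inf (nhds l) (filtermap g U))"
      unfolding eventually_inf by blast
    with l show False
      by (simp add: trivial_limit_def)
  qed
  with \<open>l \<in> K\<close> show ?thesis
    unfolding tendsto_def by blast
qed

lemma tendsto_iff_ultrafilters: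
  "(f \<longlongrightarrow> l) F \<longleftrightarrow> (\<forall>U\<le>F. ultrafilter U \<longrightarrow> (f \<longlongrightarrow> l) U)"
proof (intro iffI allI impI)
  show "(f \<longlongrightarrow> l) U" if "(f \<longlongrightarrow> l) F" "U \<le> F" for U
    using that tendsto_mono by blast
next
  assume ultra: "\<forall>U\<le>F. ultrafilter U \<longrightarrow> (f \<longlongrightarrow> l) U"
  show "(f \<longlongrightarrow> l) F"
    unfolding tendsto_def
  proof (intro allI impI)
    fix S assume S: "open S" "l \<in> S"
    show "eventually (\<lambda>x. f x \<in> S) F"
    proof (rule ccontr)
      let ?G = "inf F (principal {x. f x \<notin> S})"
      assume "\<not> eventually (\<lambda>x. f x \<in> S) F"
      then have "?G \<noteq> bot"
        by (simp add: trivial_limit_def eventually_inf_principal)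
      then obtain U where U: "U \<le> ?G" "ultrafilter U"
        using ultrafilter_le_exists by blast
      then have "(f \<longlongrightarrow> l) U"
        using ultra le_inf_iff by blast
      with S have "eventually (\<lambda>x. f x \<in> S) U"
        by (simp add: topological_tendstoD)
      moreover have "eventually (\<lambda>x. f x \<notin> S) U"
        using U(1) by (rule filter_leD) (simp add: eventually_inf_principal)
      ultimately have "eventually (\<lambda>x. False) U"
        by (rule eventually_elim2) simp
      with U(2) show False
        by (simp add: ultrafilter_def trivial_limit_def)
    qed
  qed
qed

lemma counting_Suc:
  "counting X (Suc n) = counting X n + (if Suc n \<in> X then 1 else 0)"
proof -
  have "X \<inter> {1..Suc n} = (if Suc n \<in> X then insert (Suc n) (X \<inter> {1..n}) else X \<inter> {1..n})"
    by (auto simp: le_Suc_eq)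
  then show ?thesis
    unfolding counting_def by (simp add: card_insert_disjoint)
qed

lemma counting_le: "counting X n \<le> n"
proof -
  have "card (X \<inter> {1..n}) \<le> card {1..n}"
    by (intro card_mono) auto
  then show ?thesis
    unfolding counting_def by simp
qed

lemma counting_Un_disjoint: "A \<inter> B = {} \<Longrightarrow> counting (A \<union> B) n = counting A n + counting B n"
  unfolding counting_def by (subst card_Un_disjoint[symmetric]) (auto simp: Int_Un_distrib2)

lemma counting_Diff_Int: "counting X n = counting (X - Y) n + counting (X \<inter> Y) n"
proof -
  have "(X - Y) \<inter> (X \<inter> Y) = {}"
    by blast
  then show ?thesis
    using counting_Un_disjoint by (metis Un_Diff_Int)
qed

lemma counting_pos_nat: "counting pos_nat n = n"
proof -
  have "pos_nat \<inter> {1..n} = {1..n}"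
    by (auto simp: pos_nat_def)
  then show ?thesis
    unfolding counting_def by simp
qed

lemma counting_alternate_half:
  "counting {x\<in>M. even (counting M (x - 1))} n = (counting M n + 1) div 2"
proof (induction n)
  case 0
  then show ?case
    by (simp add: counting_def)
next
  case (Suc n)
  have "Suc n \<in> {x\<in>M. even (counting M (x - 1))} \<longleftrightarrow> Suc n \<in> M \<and> even (counting M n)"
    by simp
  then show ?case
    unfolding counting_Suc Suc.IH by (cases "even (counting M n)") (auto elim!: evenE oddE)
qed

lemma exists_split_halves:
  "\<exists>M\<^sub>1 M\<^sub>2. M\<^sub>1 \<inter> M\<^sub>2 = {} \<and> M\<^sub>1 \<union> M\<^sub>2 = M \<and>
     (\<forall>n. counting M\<^sub>1 n = (counting M n + 1) div 2 \<and> counting M\<^sub>2 n = counting M n div 2)"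
proof (intro exI conjI allI)
  let ?M\<^sub>1 = "{x\<in>M. even (counting M (x - 1))}"
  show "?M\<^sub>1 \<inter> (M - ?M\<^sub>1) = {}" "?M\<^sub>1 \<union> (M - ?M\<^sub>1) = M"
    by auto
  fix n
  show "counting ?M\<^sub>1 n = (counting M n + 1) div 2"
    by (rule counting_alternate_half)
  have "?M\<^sub>1 = M \<inter> ?M\<^sub>1"
    by blast
  then have "counting M n = counting (M - ?M\<^sub>1) n + counting ?M\<^sub>1 n"
    using counting_Diff_Int[of M n ?M\<^sub>1] by simp
  then show "counting (M - ?M\<^sub>1) n = counting M n div 2"
    using counting_alternate_half[of M n] by presburger
qed

lemma tendsto_half_complement_ratio:
  fixes a b m h :: "nat \<Rightarrow> nat"
  assumes partition: "\<And>n. a n + b n + m n = n"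
    and half: "\<And>n. \<bar>2 * real (h n) - real (m n)\<bar> \<le> 1"
    and lim: "(\<lambda>n. (real (b n) - real (a n)) / real n) \<longlonglongrightarrow> L"
  shows "(\<lambda>n. real (b n + h n) / real n) \<longlonglongrightarrow> (1 + L) / 2"
proof -
  define e where "e n = (2 * real (h n) - real (m n)) / 2" for n
  have "(\<lambda>n. e n / real n) \<longlonglongrightarrow> 0"
  proof (rule Lim_null_comparison)
    show "\<forall>\<^sub>F n in sequentially. norm (e n / real n) \<le> 1 / real n"
    proof (intro always_eventually allI)
      fix n
      show "norm (e n / real n) \<le> 1 / real n"
        using half[of n] by (cases "n = 0") (auto simp: e_def abs_divide field_simps)
    qed
  qed (rule lim_const_over_n)
  then have "(\<lambda>n. 1/2 + (real (b n) - real (a n)) / real n / 2 + e n / real n)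
      \<longlonglongrightarrow> 1/2 + L/2 + 0"
    by (intro tendsto_intros lim) simp
  then have "(\<lambda>n. 1/2 + (real (b n) - real (a n)) / real n / 2 + e n / real n)
      \<longlonglongrightarrow> (1 + L) / 2"
    by (simp add: add_divide_distrib)
  moreover have "1/2 + (real (b n) - real (a n)) / real n / 2 + e n / real n
      = real (b n + h n) / real n" if "n \<ge> 1" for n
  proof -
    have "real n = real (a n) + real (b n) + real (m n)"
      using partition[of n] by (metis of_nat_add)
    then have "real (b n + h n) = (real n + (real (b n) - real (a n)) + 2 * e n) / 2"
      unfolding e_def by (simp add: field_simps)
    then have "real (b n + h n) / real n = (real n + (real (b n) - real (a n)) + 2 * e n) / 2 / real n"
      by (simp only:)
    also have "\<dots> = 1/2 + (real (b n) - real (a n)) / real n / 2 + e n / real n"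
      using that by (simp add: field_simps)
    finally show ?thesis
      by simp
  qed
  then have "\<forall>\<^sub>F n in sequentially.
      1/2 + (real (b n) - real (a n)) / real n / 2 + e n / real n = real (b n + h n) / real n"
    by (auto simp: eventually_at_top_linorder)
  ultimately show ?thesis
    by (rule Lim_transform_eventually)
qed

lemma density_measure_Un:
  assumes "density_measure \<mu>" "X \<subseteq> pos_nat" "Y \<subseteq> pos_nat" "X \<inter> Y = {}"
  shows "\<mu> (X \<union> Y) = \<mu> X + \<mu> Y"
  using assms unfolding density_measure_def by blast

lemma density_measure_pos_nat: "density_measure \<mu> \<Longrightarrow> \<mu> pos_nat = 1"
  unfolding density_measure_def by blast

lemma density_measure_Diff_Int:
  assumes "density_measure \<mu>" "X \<subseteq> pos_nat"
  shows "\<mu> X = \<mu> (X - Y) + \<mu> (X \<inter> Y)"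
proof -
  have "X - Y \<subseteq> pos_nat" "X \<inter> Y \<subseteq> pos_nat"
    using assms(2) by auto
  then have "\<mu> ((X - Y) \<union> (X \<inter> Y)) = \<mu> (X - Y) + \<mu> (X \<inter> Y)"
    by (intro density_measure_Un[OF assms(1)]) auto
  then show ?thesis
    by (simp add: Un_Diff_Int)
qed

lemma density_measure_has_density:
  assumes "density_measure \<mu>" "X \<subseteq> pos_nat" "has_density X d"
  shows "\<mu> X = d"
  using assms unfolding density_measure_def by blast

lemma density_measure_diff_disjoint:
  assumes \<mu>: "density_measure \<mu>"
    and AB: "A \<subseteq> pos_nat" "B \<subseteq> pos_nat" "A \<inter> B = {}"
    and lim: "(\<lambda>n. (real (counting B n) - real (counting A n)) / real n) \<longlonglongrightarrow> L"
  shows "\<mu> B - \<mu> A = L"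
proof -
  define M where "M = pos_nat - (A \<union> B)"
  obtain M\<^sub>1 M\<^sub>2 where M: "M\<^sub>1 \<inter> M\<^sub>2 = {}" "M\<^sub>1 \<union> M\<^sub>2 = M"
    and counting_M: "\<And>n. counting M\<^sub>1 n = (counting M n + 1) div 2 \<and> counting M\<^sub>2 n = counting M n div 2"
    using exists_split_halves[of M] by blast
  have subsets: "M \<subseteq> pos_nat" "M\<^sub>1 \<subseteq> pos_nat" "M\<^sub>2 \<subseteq> pos_nat" "A \<union> B \<subseteq> pos_nat"
    using AB M unfolding M_def by auto
  have disjoint: "(A \<union> B) \<inter> M = {}" "B \<inter> M\<^sub>1 = {}" "B \<inter> M\<^sub>2 = {}"
    using M unfolding M_def by auto
  have pos_nat_eq: "pos_nat = (A \<union> B) \<union> M"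
    using subsets(4) unfolding M_def by blast
  have partition: "counting A n + counting B n + counting M n = n" for n
    using counting_Un_disjoint[OF disjoint(1), of n] counting_Un_disjoint[OF AB(3), of n]
    by (simp add: counting_pos_nat flip: pos_nat_eq)
  have density_half: "has_density (B \<union> H) ((1 + L) / 2)"
    if "B \<inter> H = {}" "\<And>n. \<bar>2 * real (counting H n) - real (counting M n)\<bar> \<le> 1" for H
    unfolding has_density_def counting_Un_disjoint[OF that(1)]
    using partition that(2) lim by (rule tendsto_half_complement_ratio)
  have halves: "\<bar>2 * real ((c + 1) div 2) - real c\<bar> \<le> 1" "\<bar>2 * real (c div 2) - real c\<bar> \<le> 1"
    for c :: nat
    by (cases "even c"; auto elim!: evenE oddE)+
  have "has_density (B \<union> M\<^sub>1) ((1 + L) / 2)" "has_density (B \<union> M\<^sub>2) ((1 + L) / 2)"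
    using density_half[OF disjoint(2)] density_half[OF disjoint(3)] counting_M halves by simp_all
  then have "\<mu> B + \<mu> M\<^sub>1 = (1 + L) / 2" "\<mu> B + \<mu> M\<^sub>2 = (1 + L) / 2"
    using density_measure_has_density[OF \<mu>] density_measure_Un[OF \<mu>] subsets AB(2) disjoint(2,3)
    by (metis le_sup_iff)+
  moreover have "\<mu> M = \<mu> M\<^sub>1 + \<mu> M\<^sub>2"
    using density_measure_Un[OF \<mu> subsets(2,3) M(1)] M(2) by simp
  moreover have "\<mu> A + \<mu> B + \<mu> M = 1"
    using density_measure_Un[OF \<mu> subsets(4,1) disjoint(1)] density_measure_Un[OF \<mu> AB]
      density_measure_pos_nat[OF \<mu>] by (simp flip: pos_nat_eq)
  ultimately show ?thesis
    by (simp add: field_simps)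
qed

lemma density_measure_diff:
  assumes \<mu>: "density_measure \<mu>" and AB: "A \<subseteq> pos_nat" "B \<subseteq> pos_nat"
    and lim: "(\<lambda>n. (real (counting B n) - real (counting A n)) / real n) \<longlonglongrightarrow> L"
  shows "\<mu> B - \<mu> A = L"
proof -
  have "real (counting B n) - real (counting A n) = real (counting (B - A) n) - real (counting (A - B) n)"
    for n
    using counting_Diff_Int[of B n A] counting_Diff_Int[of A n B] by (simp add: Int_commute)
  with lim have "\<mu> (B - A) - \<mu> (A - B) = L"
    using AB by (intro density_measure_diff_disjoint[OF \<mu>]) auto
  moreover have "\<mu> B = \<mu> (B - A) + \<mu> (B \<inter> A)" "\<mu> A = \<mu> (A - B) + \<mu> (A \<inter> B)"
    using density_measure_Diff_Int[OF \<mu>] AB by blast+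
  ultimately show ?thesis
    by (simp add: Int_commute)
qed

definition ultrafilter_density :: "nat filter \<Rightarrow> nat set \<Rightarrow> real" where
  "ultrafilter_density U X = Lim U (\<lambda>n. real (counting X n) / real n)"

lemma tendsto_ultrafilter_density:
  assumes "ultrafilter U"
  shows "((\<lambda>n. real (counting X n) / real n) \<longlongrightarrow> ultrafilter_density U X) U"
proof -
  have "real (counting X n) / real n \<in> {0..1}" for n
    using counting_le[of X n] by (cases "n = 0") (auto simp: divide_le_eq_1)
  then have "\<forall>\<^sub>F n in U. real (counting X n) / real n \<in> {0..1}"
    by (intro always_eventually allI)
  from ultrafilter_convergent_compact[OF assms compact_Icc this]
  obtain l where "((\<lambda>n. real (counting X n) / real n) \<longlongrightarrow> l) U"
    by blast
  with assms show ?thesis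
    unfolding ultrafilter_density_def ultrafilter_def by (simp add: tendsto_Lim)
qed

lemma density_measure_ultrafilter_density:
  assumes U: "ultrafilter U" "U \<le> sequentially"
  shows "density_measure (ultrafilter_density U)"
proof -
  let ?r = "\<lambda>X n. real (counting X n) / real n"
  have lim: "(?r X \<longlongrightarrow> ultrafilter_density U X) U" for X
    using tendsto_ultrafilter_density[OF U(1)] .
  have "U \<noteq> bot"
    using U(1) by (simp add: ultrafilter_def)
  then have unique: "ultrafilter_density U X = d" if "(?r X \<longlongrightarrow> d) U" for X d
    using tendsto_unique lim that by blast
  have "ultrafilter_density U X = d" if "has_density X d" for X d
    using that U(2) tendsto_mono unique unfolding has_density_def by blast
  moreover have "has_density pos_nat 1"
  proof -
    have "\<forall>\<^sub>F n in sequentially. 1 = ?r pos_nat n"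
      unfolding counting_pos_nat eventually_at_top_linorder by (intro exI[of _ 1]) auto
    then show ?thesis
      unfolding has_density_def by (rule Lim_transform_eventually[OF tendsto_const])
  qed
  moreover have "ultrafilter_density U (X \<union> Y) = ultrafilter_density U X + ultrafilter_density U Y"
    if "X \<inter> Y = {}" for X Y
  proof (rule unique)
    have "?r (X \<union> Y) = (\<lambda>n. ?r X n + ?r Y n)"
      using that by (auto simp: counting_Un_disjoint add_divide_distrib)
    then show "(?r (X \<union> Y) \<longlongrightarrow> ultrafilter_density U X + ultrafilter_density U Y) U"
      by (simp add: tendsto_add lim)
  qed
  moreover have "0 \<le> ultrafilter_density U X \<and> ultrafilter_density U X \<le> 1" for X
  proof -
    have "0 \<le> ?r X n \<and> ?r X n \<le> 1" for n
      using counting_le[of X n] by (cases "n = 0") (auto simp: divide_le_eq_1)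
    then show ?thesis
      using tendsto_lowerbound[OF lim] tendsto_upperbound[OF lim] \<open>U \<noteq> bot\<close>
      by (simp add: always_eventually)
  qed
  ultimately show ?thesis
    unfolding density_measure_def by blast
qed

theorem proposition3p14:
  fixes A B :: "nat set" and L :: real
  assumes "A \<subseteq> pos_nat" and "B \<subseteq> pos_nat"
  shows "((\<lambda>n. (real (counting B n) - real (counting A n)) / real n) \<longlonglongrightarrow> L)
         \<longleftrightarrow> (\<forall>\<mu>. density_measure \<mu> \<longrightarrow> \<mu> B - \<mu> A = L)"
proof
  assume "(\<lambda>n. (real (counting B n) - real (counting A n)) / real n) \<longlonglongrightarrow> L"
  then show "\<forall>\<mu>. density_measure \<mu> \<longrightarrow> \<mu> B - \<mu> A = L"
    using assms density_measure_diff by blast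
next
  assume all_measures: "\<forall>\<mu>. density_measure \<mu> \<longrightarrow> \<mu> B - \<mu> A = L"
  show "(\<lambda>n. (real (counting B n) - real (counting A n)) / real n) \<longlonglongrightarrow> L"
    unfolding tendsto_iff_ultrafilters[where F = sequentially]
  proof (intro allI impI)
    fix U :: "nat filter"
    assume U: "U \<le> sequentially" "ultrafilter U"
    then have "ultrafilter_density U B - ultrafilter_density U A = L"
      using all_measures density_measure_ultrafilter_density by blast
    moreover have "((\<lambda>n. real (counting B n) / real n - real (counting A n) / real n)
        \<longlongrightarrow> ultrafilter_density U B - ultrafilter_density U A) U"
      by (intro tendsto_diff tendsto_ultrafilter_density U(2))
    ultimately show "((\<lambda>n. (real (counting B n) - real (counting A n)) / real n) \<longlongrightarrow> L) U"
      by (simp add: diff_divide_distrib)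
  qed
qed

end
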